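(* Let $a,b,r>0$ and let $g(u)=\frac{\exp(-bu)}{(1+\exp(-au))^r}$, $u\ge0$. Let $\mathbf X\sim GML_n(\boldsymbol\mu,\mathbf\Sigma,g)$, and for fixed $1\le m<n$ partition $$\mathbf X=\begin{pmatrix}\mathbf X^{(1)}\\ \mathbf X^{(2)}\end{pmatrix},\quad \boldsymbol\mu=\begin{pmatrix}\boldsymbol\mu^{(1)}\\ \boldsymbol\mu^{(2)}\end{pmatrix},\quad \mathbf\Sigma=\begin{pmatrix}\mathbf\Sigma_{11}&\mathbf\Sigma_{12}\\ \mathbf\Sigma_{21}&\mathbf\Sigma_{22}\end{pmatrix},$$ where $\mathbf X^{(1)},\boldsymbol\mu^{(1)}\in\mathbb R^m$, $\mathbf X^{(2)},\boldsymbol\mu^{(2)}\in\mathbb R^{n-m}$, $\mathbf\Sigma_{11}$ is $m\times m$, $\mathbf\Sigma_{12}$ is $m\times(n-m)$, $\mathbf\Sigma_{21}$ is $(n-m)\times m$ and $\mathbf\Sigma_{22}$ is $(n-m)\times(n-m)$. Then, conditionally on $\mathbf X^{(1)}=\mathbf x^{(1)}$, the conditional distribution of $\mathbf X^{(2)}$ is the elliptical distribution $Ell_{n-m}(\boldsymbol\mu_{2.1},\mathbf\Sigma_{22.1},g_{(2.1)})$, where $$\boldsymbol\mu_{2.1}=\boldsymbol\mu^{(2)}+\mathbf\Sigma_{21}\mathbf\Sigma_{11}^{-1}(\mathbf x^{(1)}-\boldsymbol\mu^{(1)}),\qquad \mathbf\Sigma_{22.1}=\mathbf\Sigma_{22}-\mathbf\Sigma_{21}\mathbf\Sigma_{11}^{-1}\mathbf\Sigma_{12},$$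 and $$g_{(2.1)}(t)=\frac{e^{-b[t+(\mathbf x^{(1)}-\boldsymbol\mu^{(1)})'\mathbf\Sigma_{11}^{-1}(\mathbf x^{(1)}-\boldsymbol\mu^{(1)})]}}{\left(1+e^{-a[t+(\mathbf x^{(1)}-\boldsymbol\mu^{(1)})'\mathbf\Sigma_{11}^{-1}(\mathbf x^{(1)}-\boldsymbol\mu^{(1)})]}\right)^r},\quad t\ge0.$$
   Context: $\boldsymbol\mu\in\mathbb R^n$ and $\mathbf\Sigma$ is a symmetric positive definite $n\times n$ matrix; a prime denotes transpose. The conditional distribution is the one given by the conditional density (joint density of $\mathbf X$ divided by the marginal density of $\mathbf X^{(1)}$ at $\mathbf x^{(1)}$). $\mathbf Z\sim Ell_k(\boldsymbol\nu,\mathbf S,h)$ (elliptically symmetric distribution with location $\boldsymbol\nu\in\mathbb R^k$, symmetric positive definite scale matrix $\mathbf S$ and density generator $h\ge 0$) means that $\mathbf Z$ has density on $\mathbb R^k$ equal to $C|\mathbf S|^{-1/2}h\big((\mathbf z-\boldsymbol\nu)'\mathbf S^{-1}(\mathbf z-\boldsymbol\nu)\big)$, with $C>0$ the normalizing constant (so $h$ matters only up to a positive constant factor). For $a,b,r>0$ and $g(u)=\frac{\exp(-bu)}{(1+\exp(-au))^r}$, $\mathbf X\sim GML_n(\boldsymbol\mu,\mathbf\Sigma,g)$ (generalized elliptically symmetric logistic distribution) means $\mathbf X\sim Ell_n(\boldsymbol\mu,\mathbf\Sigma,g)$ for this $g$. *)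

theory Defs
  imports "HOL-Probability.Probability"
begin

text \<open>
  A partition of an n-dimensional vector into its first m and its last n - m coordinates is
  expressed by indexing with a disjoint sum \<open>'m + 'k\<close>, where \<open>CARD('m)\<close> is m and \<open>CARD('k)\<close> is
  n - m; as types are nonempty, this covers exactly the pairs with 1 \<le> m < n.
\<close>

definition part1 :: "real ^ ('m::finite + 'k::finite) \<Rightarrow> real ^ 'm"
  where "part1 z = (\<chi> i. z $ Inl i)"

definition part2 :: "real ^ ('m::finite + 'k::finite) \<Rightarrow> real ^ 'k"
  where "part2 z = (\<chi> j. z $ Inr j)"

definition join :: "real ^ 'm::finite \<Rightarrow> real ^ 'k::finite \<Rightarrow> real ^ ('m + 'k)"
  where "join x y = (\<chi> l. case l of Inl i \<Rightarrow> x $ i | Inr j \<Rightarrow> y $ j)"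

definition block11 :: "real ^ ('m::finite + 'k::finite) ^ ('m + 'k) \<Rightarrow> real ^ 'm ^ 'm"
  where "block11 A = (\<chi> i j. A $ Inl i $ Inl j)"

definition block12 :: "real ^ ('m::finite + 'k::finite) ^ ('m + 'k) \<Rightarrow> real ^ 'k ^ 'm"
  where "block12 A = (\<chi> i j. A $ Inl i $ Inr j)"

definition block21 :: "real ^ ('m::finite + 'k::finite) ^ ('m + 'k) \<Rightarrow> real ^ 'm ^ 'k"
  where "block21 A = (\<chi> i j. A $ Inr i $ Inl j)"

definition block22 :: "real ^ ('m::finite + 'k::finite) ^ ('m + 'k) \<Rightarrow> real ^ 'k ^ 'k"
  where "block22 A = (\<chi> i j. A $ Inr i $ Inr j)"

definition sym_pos_def :: "real ^ 'n ^ 'n::finite \<Rightarrow> bool"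
  where "sym_pos_def S \<longleftrightarrow> transpose S = S \<and> (\<forall>v. v \<noteq> 0 \<longrightarrow> 0 < v \<bullet> (S *v v))"

definition quad :: "real ^ 'n ^ 'n::finite \<Rightarrow> real ^ 'n \<Rightarrow> real"
  where "quad S v = v \<bullet> (matrix_inv S *v v)"

definition ell_kernel ::
    "real ^ 'n::finite \<Rightarrow> real ^ 'n ^ 'n \<Rightarrow> (real \<Rightarrow> real) \<Rightarrow> real ^ 'n \<Rightarrow> real"
  where "ell_kernel \<nu> S h z = det S powr (- 1 / 2) * h (quad S (z - \<nu>))"

text \<open>If the kernel is not integrable, or has integral 0, this constant is 0.\<close>

definition ell_const ::
    "real ^ 'n::finite \<Rightarrow> real ^ 'n ^ 'n \<Rightarrow> (real \<Rightarrow> real) \<Rightarrow> real"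
  where "ell_const \<nu> S h = 1 / (LINT z|lborel. ell_kernel \<nu> S h z)"

definition ell_density ::
    "real ^ 'n::finite \<Rightarrow> real ^ 'n ^ 'n \<Rightarrow> (real \<Rightarrow> real) \<Rightarrow> real ^ 'n \<Rightarrow> real"
  where "ell_density \<nu> S h z = ell_const \<nu> S h * ell_kernel \<nu> S h z"

text \<open>
  \<open>elliptical M Z \<nu> S h\<close>: under \<open>M\<close>, the random vector \<open>Z\<close> is \<open>Ell(\<nu>, S, h)\<close>. With the identity
  for \<open>Z\<close>, this says that \<open>M\<close> itself, as a measure on Euclidean space, is that distribution.
  Only the values of the generator \<open>h\<close> on the nonnegative reals matter.
\<close>

definition elliptical ::
    "'w measure \<Rightarrow> ('w \<Rightarrow> real ^ 'n::finite) \<Rightarrow> real ^ 'n \<Rightarrow> real ^ 'n ^ 'n \<Rightarrow> (real \<Rightarrow> real) \<Rightarrow> bool"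
  where "elliptical M Z \<nu> S h \<longleftrightarrow>
    prob_space M \<and> sym_pos_def S \<and> (\<forall>u\<ge>0. 0 \<le> h u) \<and> 0 < ell_const \<nu> S h \<and>
    distributed M lborel Z (\<lambda>z. ennreal (ell_density \<nu> S h z))"

definition gml_gen :: "real \<Rightarrow> real \<Rightarrow> real \<Rightarrow> real \<Rightarrow> real"
  where "gml_gen a b r u = exp (- b * u) / (1 + exp (- a * u)) powr r"

definition GML ::
    "'w measure \<Rightarrow> ('w \<Rightarrow> real ^ 'n::finite) \<Rightarrow> real ^ 'n \<Rightarrow> real ^ 'n ^ 'n \<Rightarrow>
      real \<Rightarrow> real \<Rightarrow> real \<Rightarrow> bool"
  where "GML M X \<mu> \<Sigma> a b r \<longleftrightarrow> 0 < a \<and> 0 < b \<and> 0 < r \<and> elliptical M X \<mu> \<Sigma> (gml_gen a b r)"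

definition marginal_density1 :: "(real ^ ('m::finite + 'k::finite) \<Rightarrow> real) \<Rightarrow> real ^ 'm \<Rightarrow> real"
  where "marginal_density1 f x = (LINT y|lborel. f (join x y))"

text \<open>
  The conditional law of the second block given that the first block equals \<open>x\<close>, for a random
  vector with joint density \<open>f\<close>. It is determined pointwise in \<open>x\<close> by the chosen version of \<open>f\<close>
  and is meaningful where the marginal density is positive.
\<close>

definition cond_density ::
    "(real ^ ('m::finite + 'k::finite) \<Rightarrow> real) \<Rightarrow> real ^ 'm \<Rightarrow> real ^ 'k \<Rightarrow> real"
  where "cond_density f x y = f (join x y) / marginal_density1 f x"

definition cond_distr ::
    "(real ^ ('m::finite + 'k::finite) \<Rightarrow> real) \<Rightarrow> real ^ 'm \<Rightarrow> (real ^ 'k) measure"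
  where "cond_distr f x = density lborel (\<lambda>y. ennreal (cond_density f x y))"

end

theory Submission
  imports Defs
begin

text \<open>
  Completing the square with the Schur complement splits the quadratic form of \<open>\<Sigma>\<close> at \<open>join x y\<close>
  into \<open>q x\<close>, which depends on \<open>x\<close> only, plus the quadratic form of \<open>\<Sigma>\<^bsub>22.1\<^esub>\<close> at
  \<open>y - \<mu>\<^bsub>2.1\<^esub>\<close>, so every section of the joint density is a multiple of an elliptical kernel.
  The determinants cancel in the normalization. By Tonelli almost every section is integrable; as
  \<open>g (t + p) / g (t + q)\<close> is bounded in \<open>t \<ge> 0\<close> for fixed \<open>p\<close> and \<open>q \<ge> 0\<close>, one integrable section
  makes all of them integrable.
\<close>

section \<open>Vectors and matrices in block form\<close>

lemma part1_join [simp]: "part1 (join x y) = x"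
  by (simp add: part1_def join_def vec_eq_iff)

lemma part2_join [simp]: "part2 (join x y) = y"
  by (simp add: part2_def join_def vec_eq_iff)

lemma join_parts [simp]: "join (part1 z) (part2 z) = z"
  by (auto simp: part1_def part2_def join_def vec_eq_iff split: sum.split)

lemma part1_diff: "part1 (x - y) = part1 x - part1 y"
  by (simp add: part1_def vec_eq_iff)

lemma part2_diff: "part2 (x - y) = part2 x - part2 y"
  by (simp add: part2_def vec_eq_iff)

lemma sum_UNIV_sum:
  fixes g :: "'m::finite + 'k::finite \<Rightarrow> 'a::comm_monoid_add"
  shows "(\<Sum>l\<in>UNIV. g l) = (\<Sum>i\<in>UNIV. g (Inl i)) + (\<Sum>j\<in>UNIV. g (Inr j))"
  using sum.Plus[of UNIV UNIV g] by (simp add: o_def)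

lemma prod_UNIV_sum:
  fixes g :: "'m::finite + 'k::finite \<Rightarrow> 'a::comm_monoid_mult"
  shows "(\<Prod>l\<in>UNIV. g l) = (\<Prod>i\<in>UNIV. g (Inl i)) * (\<Prod>j\<in>UNIV. g (Inr j))"
  using prod.Plus[of UNIV UNIV g] by (simp add: o_def)

lemma inner_parts: "z \<bullet> w = part1 z \<bullet> part1 w + part2 z \<bullet> part2 w"
  by (simp add: inner_vec_def sum_UNIV_sum part1_def part2_def)

lemma part1_mult: "part1 (A *v z) = block11 A *v part1 z + block12 A *v part2 z"
  by (simp add: vec_eq_iff part1_def part2_def block11_def block12_def matrix_vector_mult_def
      sum_UNIV_sum)

lemma part2_mult: "part2 (A *v z) = block21 A *v part1 z + block22 A *v part2 z"
  by (simp add: vec_eq_iff part1_def part2_def block21_def block22_def matrix_vector_mult_def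
      sum_UNIV_sum)

lemma parts_eq_iff: "z = w \<longleftrightarrow> part1 z = part1 w \<and> part2 z = part2 w"
  by (metis join_parts)

lemma part_0 [simp]: "part1 0 = 0" "part2 0 = 0"
  by (simp_all add: part1_def part2_def vec_eq_iff)

section \<open>Symmetric positive definite matrices, their inverses and blocks\<close>

lemma sym_pos_def_invertible:
  assumes "sym_pos_def S"
  shows "invertible S"
proof -
  have "x = 0" if "S *v x = 0" for x
    using assms that unfolding sym_pos_def_def by (metis inner_zero_right less_irrefl)
  then show ?thesis
    by (simp add: invertible_left_inverse matrix_left_invertible_ker)
qed

lemma mult_matrix_inv_cancel:
  assumes "invertible (S :: real ^ 'n ^ 'n)"
  shows "S *v (matrix_inv S *v x) = x" "matrix_inv S *v (S *v x) = x"
proof -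
  have "S ** matrix_inv S = mat 1 \<and> matrix_inv S ** S = mat 1"
    using assms unfolding invertible_def matrix_inv_def by (rule someI_ex)
  then show "S *v (matrix_inv S *v x) = x" "matrix_inv S *v (S *v x) = x"
    by (simp_all add: matrix_vector_mul_assoc)
qed

text \<open>Substituting \<open>?w = matrix_inv S *v v\<close> turns the form of the inverse at
  \<open>v\<close> into the form of \<open>S\<close> at \<open>?w\<close>.\<close>

lemma quad_nonneg:
  assumes "sym_pos_def S"
  shows "0 \<le> quad S v"
proof -
  let ?w = "matrix_inv S *v v"
  have "quad S v = ?w \<bullet> (S *v ?w)"
    by (simp add: quad_def mult_matrix_inv_cancel sym_pos_def_invertible[OF assms] inner_commute)
  then show ?thesis
    using assms unfolding sym_pos_def_def
    by (metis inner_zero_left less_imp_le order_refl)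
qed

text \<open>Self-adjointness passes from \<open>S\<close> to its inverse: write \<open>x\<close> as
  \<open>S\<close> applied to its preimage and move \<open>S\<close> across the inner
  product.\<close>

lemma symmetric_matrix_inv:
  assumes "sym_pos_def S"
  shows "x \<bullet> (matrix_inv S *v y) = (matrix_inv S *v x) \<bullet> y"
proof -
  have "x \<bullet> (matrix_inv S *v y) = (S *v (matrix_inv S *v x)) \<bullet> (matrix_inv S *v y)"
    by (simp add: mult_matrix_inv_cancel sym_pos_def_invertible[OF assms])
  also have "\<dots> = (matrix_inv S *v x) \<bullet> (S *v (matrix_inv S *v y))"
    using assms by (metis dot_lmul_matrix transpose_matrix_vector sym_pos_def_def)
  finally show ?thesis
    by (simp add: mult_matrix_inv_cancel sym_pos_def_invertible[OF assms])
qed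

lemma sym_pos_def_blocks:
  assumes "sym_pos_def A"
  shows "transpose (block11 A) = block11 A" "transpose (block22 A) = block22 A"
    "transpose (block12 A) = block21 A" "transpose (block21 A) = block12 A"
  using assms
  by (auto simp: sym_pos_def_def transpose_def vec_eq_iff block11_def block22_def block12_def
      block21_def)

text \<open>The form of the block is the form of \<open>A\<close> on vectors whose second part is
  0.\<close>

lemma sym_pos_def_block11:
  fixes A :: "real ^ ('m::finite + 'k::finite) ^ ('m + 'k)"
  assumes "sym_pos_def A"
  shows "sym_pos_def (block11 A)"
  unfolding sym_pos_def_def
proof (intro conjI allI impI)
  show "transpose (block11 A) = block11 A"
    using assms by (rule sym_pos_def_blocks)
  fix v :: "real ^ 'm"
  assume "v \<noteq> 0"
  then have "join v (0 :: real ^ 'k) \<noteq> 0"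
    by (auto simp: parts_eq_iff)
  then have "0 < join v 0 \<bullet> (A *v join v 0)"
    using assms unfolding sym_pos_def_def by blast
  then show "0 < v \<bullet> (block11 A *v v)"
    by (simp add: inner_parts part1_mult)
qed

section \<open>The Schur complement and completion of the square\<close>

definition schur :: "real ^ ('m::finite + 'k::finite) ^ ('m + 'k) \<Rightarrow> real ^ 'k ^ 'k"
  where "schur A = block22 A - block21 A ** matrix_inv (block11 A) ** block12 A"

lemma schur_mult:
  "schur A *v w = block22 A *v w - block21 A *v (matrix_inv (block11 A) *v (block12 A *v w))"
  by (simp add: schur_def matrix_vector_mult_diff_rdistrib matrix_vector_mul_assoc matrix_mul_assoc)

lemma sym_pos_def_schur:
  assumes A: "sym_pos_def A"
  shows "sym_pos_def (schur A)"
  unfolding sym_pos_def_def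
proof (intro conjI allI impI)
  \<comment> \<open>Uniqueness of adjoints turns the self-adjointness of the inverse into symmetry
    of its matrix.\<close>
  have "transpose (matrix_inv (block11 A)) = matrix_inv (block11 A)"
    using symmetric_matrix_inv[OF sym_pos_def_block11[OF A]]
    by (metis adjoint_matrix adjoint_unique matrix_of_matrix_vector_mul matrix_vector_mul_linear)
  moreover have "transpose (B - C) = transpose B - transpose C" for B C :: "real ^ 'b ^ 'b"
    by (simp add: transpose_def vec_eq_iff)
  ultimately show "transpose (schur A) = schur A"
    by (simp add: schur_def matrix_transpose_mul sym_pos_def_blocks[OF A] matrix_mul_assoc)
  fix w assume w: "w \<noteq> (0 :: real ^ 'b)"
  \<comment> \<open>Among all vectors with second part \<open>w\<close>, \<open>join u w\<close>
    minimizes the form of \<open>A\<close>: this \<open>u\<close> makes the first part of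
    \<open>A *v join u w\<close> vanish, and the form of the Schur complement at \<open>w\<close> is
    what remains.\<close>
  define u where "u = - (matrix_inv (block11 A) *v (block12 A *v w))"
  have "join u w \<noteq> 0"
    using w by (auto simp: parts_eq_iff)
  then have "0 < join u w \<bullet> (A *v join u w)"
    using A unfolding sym_pos_def_def by blast
  also have "block11 A *v u + block12 A *v w = 0"
    by (simp add: u_def mult_matrix_inv_cancel linear_neg[OF matrix_vector_mul_linear]
        sym_pos_def_invertible[OF sym_pos_def_block11[OF A]])
  then have "join u w \<bullet> (A *v join u w) = w \<bullet> (schur A *v w)"
    by (simp add: inner_parts part1_mult part2_mult schur_mult)
       (simp add: u_def linear_neg[OF matrix_vector_mul_linear])
  finally show "0 < w \<bullet> (schur A *v w)" .
qed

text \<open>With \<open>z = A *v w\<close> the left side is \<open>z \<bullet> w\<close>, and the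
  residual of the second part is \<open>schur A *v part2 w\<close>. Both terms on the right then
  become inner products with the parts of \<open>w\<close>.\<close>

lemma quad_schur:
  assumes A: "sym_pos_def A"
  shows "quad A z = quad (block11 A) (part1 z) +
    quad (schur A) (part2 z - block21 A *v (matrix_inv (block11 A) *v part1 z))"
proof -
  note [simp] = mult_matrix_inv_cancel sym_pos_def_invertible
  note A11 = sym_pos_def_block11[OF A] and S = sym_pos_def_schur[OF A]
  let ?I = "matrix_inv (block11 A)"
  define w where "w = matrix_inv A *v z"
  have "A *v w = z"
    by (simp add: w_def A)
  then have z1: "part1 z = block11 A *v part1 w + block12 A *v part2 w"
    and z2: "part2 z = block21 A *v part1 w + block22 A *v part2 w"
    by (auto simp flip: part1_mult part2_mult)
  have w1: "?I *v part1 z = part1 w + ?I *v (block12 A *v part2 w)"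
    by (simp add: z1 matrix_vector_right_distrib A11)
  have v: "part2 z - block21 A *v (?I *v part1 z) = schur A *v part2 w"
    unfolding w1 by (simp add: z2 schur_mult matrix_vector_right_distrib)
  \<comment> \<open>This is the cross term: it enters the form of \<open>block11 A\<close> with a
    plus sign and that of the Schur complement with a minus sign, and so cancels in the sum.\<close>
  have "part1 z \<bullet> (?I *v (block12 A *v part2 w)) = (block21 A *v (?I *v part1 z)) \<bullet> part2 w"
    using symmetric_matrix_inv[OF A11] sym_pos_def_blocks[OF A]
    by (metis dot_lmul_matrix transpose_matrix_vector)
  moreover have "quad (schur A) (schur A *v part2 w) = (schur A *v part2 w) \<bullet> part2 w"
    by (simp add: quad_def S)
  ultimately show ?thesis
    unfolding v[symmetric]
    by (simp add: quad_def[of A] quad_def[of "block11 A"] inner_parts[of z] w1 inner_add_right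
        inner_diff_left flip: w_def)
qed

section \<open>Lebesgue measure and joint densities in block form\<close>

lemma continuous_on_join: "continuous_on UNIV (\<lambda>(x, y). join x y)"
proof -
  have "continuous_on UNIV (\<lambda>p. case l of Inl i \<Rightarrow> fst p $ i | Inr j \<Rightarrow> snd p $ j)" for l :: "'a + 'b"
    by (cases l) (auto intro!: continuous_intros)
  then show ?thesis
    by (auto simp: join_def case_prod_beta intro!: continuous_on_vec_lambda)
qed

lemma measurable_join [measurable]: "(\<lambda>(x, y). join x y) \<in> borel \<Otimes>\<^sub>M borel \<rightarrow>\<^sub>M borel"
  using borel_measurable_continuous_onI[OF continuous_on_join] by (simp add: borel_prod)

lemma measurable_part1 [measurable]: "part1 \<in> borel_measurable borel"
  unfolding part1_def
  by (intro borel_measurable_continuous_onI continuous_on_vec_lambda continuous_intros)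

lemma measurable_part2 [measurable]: "part2 \<in> borel_measurable borel"
  unfolding part2_def
  by (intro borel_measurable_continuous_onI continuous_on_vec_lambda continuous_intros)

lemma prod_Basis_vec: "(\<Prod>b\<in>Basis. x \<bullet> b) = (\<Prod>i\<in>UNIV. x $ i)" for x :: "real ^ 'n"
proof -
  have "inj (\<lambda>i::'n. axis i (1::real))"
    by (simp add: inj_on_def axis_eq_axis)
  moreover have "(Basis :: (real ^ 'n) set) = range (\<lambda>i. axis i 1)"
    by (auto simp: Basis_vec_def)
  ultimately show ?thesis
    using prod.reindex[of "\<lambda>i::'n. axis i (1::real)" UNIV "\<lambda>b. x \<bullet> b"]
    by (simp add: inner_axis o_def)
qed

lemma emeasure_lborel_box_vec:
  fixes l u :: "real ^ 'n"
  assumes "\<And>i. l $ i \<le> u $ i"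
  shows "emeasure lborel (box l u) = (\<Prod>i\<in>UNIV. (u - l) $ i)"
  using assms
  by (subst emeasure_lborel_box) (auto simp: prod_Basis_vec, auto simp: Basis_vec_def inner_axis)

text \<open>Lebesgue measure is determined by the volumes of boxes. Under \<open>join\<close> a box
  pulls back to a product of two boxes, and its volume factors accordingly.\<close>

lemma lborel_eq_distr_join:
  "(lborel :: (real ^ ('m::finite + 'k::finite)) measure) =
    distr (lborel \<Otimes>\<^sub>M lborel) lborel (\<lambda>(x, y). join x y)"
proof (rule lborel_eqI)
  fix l u :: "real ^ ('m + 'k)"
  assume "\<And>b. b \<in> Basis \<Longrightarrow> l \<bullet> b \<le> u \<bullet> b"
  then have le: "l $ i \<le> u $ i" for i
    by (metis axis_in_Basis_iff cart_eq_inner_axis Basis_real_def insertI1)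
  have "emeasure (distr (lborel \<Otimes>\<^sub>M lborel) lborel (\<lambda>(x, y). join x y)) (box l u) =
      emeasure (lborel \<Otimes>\<^sub>M lborel) ((\<lambda>(x, y). join x y) -` box l u)"
    by (subst emeasure_distr) (simp_all add: space_pair_measure)
  also have "(\<lambda>(x, y). join x y) -` box l u = box (part1 l) (part1 u) \<times> box (part2 l) (part2 u)"
    by (auto simp: mem_box_cart join_def part1_def part2_def split_sum_all split: sum.split)
  also have "emeasure (lborel \<Otimes>\<^sub>M lborel) \<dots> =
      ennreal (\<Prod>i\<in>UNIV. (part1 u - part1 l) $ i) * ennreal (\<Prod>i\<in>UNIV. (part2 u - part2 l) $ i)"
    by (subst lborel.emeasure_pair_measure_Times)
       (auto simp: emeasure_lborel_box_vec le part1_def part2_def)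
  also have "\<dots> = ennreal (\<Prod>i\<in>UNIV. (u - l) $ i)"
    by (simp add: prod_UNIV_sum ennreal_mult prod_nonneg le part1_def part2_def)
  finally show "emeasure (distr (lborel \<Otimes>\<^sub>M lborel) lborel (\<lambda>(x, y). join x y)) (box l u) =
      (\<Prod>b\<in>Basis. (u - l) \<bullet> b)"
    by (simp only: prod_Basis_vec)
qed simp

text \<open>Splitting into parts inverts \<open>join\<close>, which preserves Lebesgue measure, so
  the density is merely rewritten in the new variables, with Jacobian 1.\<close>

lemma distributed_parts:
  fixes X :: "'w \<Rightarrow> real ^ ('m::finite + 'k::finite)"
  assumes X: "distributed M lborel X f"
  shows "distributed M (lborel \<Otimes>\<^sub>M lborel) (\<lambda>\<omega>. (part1 (X \<omega>), part2 (X \<omega>))) (\<lambda>(x, y). f (join x y))"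
proof -
  have [measurable]: "f \<in> borel_measurable borel" "X \<in> borel_measurable M"
    using X by (auto simp: distributed_def)
  let ?L = "lborel \<Otimes>\<^sub>M lborel :: ((real ^ 'm) \<times> (real ^ 'k)) measure"
  let ?p = "\<lambda>z. (part1 z, part2 z) :: (real ^ 'm) \<times> (real ^ 'k)"
  have [measurable]: "?p \<in> lborel \<rightarrow>\<^sub>M ?L" "(\<lambda>(x, y). join x y) \<in> ?L \<rightarrow>\<^sub>M lborel"
    by measurable
  have "distr M ?L (\<lambda>\<omega>. ?p (X \<omega>)) = distr (distr M lborel X) ?L ?p"
    by (subst distr_distr) (simp_all add: o_def)
  also have "distr M lborel X = density lborel f"
    using X by (simp add: distributed_def)
  \<comment> \<open>Seeing \<open>lborel\<close> as an image under \<open>join\<close> pulls the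
    density back to the product; the outer map \<open>?p\<close> then undoes
    \<open>join\<close>.\<close>
  also have "\<dots> = distr (density ?L (\<lambda>(x, y). f (join x y))) lborel (\<lambda>(x, y). join x y)"
    by (subst lborel_eq_distr_join, subst density_distr) (simp_all add: case_prod_beta')
  also have "distr \<dots> ?L ?p = density ?L (\<lambda>(x, y). f (join x y))"
    by (subst distr_distr) (simp_all add: o_def case_prod_beta' distr_id2)
  finally show ?thesis
    unfolding distributed_def by simp
qed

section \<open>The logistic generator\<close>

lemma one_plus_exp_pos: "0 < 1 + exp (x::real)"
  by (simp add: add_pos_pos)

lemma gml_gen_pos: "0 < gml_gen a b r u"
  using one_plus_exp_pos[of "- a * u"] by (simp add: gml_gen_def)

lemma continuous_on_gml_gen: "continuous_on UNIV (gml_gen a b r)"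
  unfolding gml_gen_def using one_plus_exp_pos
  by (intro continuous_intros) (auto simp: less_imp_neq[symmetric])

lemma measurable_gml_gen [measurable]: "gml_gen a b r \<in> borel_measurable borel"
  by (rule borel_measurable_continuous_onI[OF continuous_on_gml_gen])

lemma measurable_quad [measurable]: "quad S \<in> borel_measurable borel"
  unfolding quad_def
  by (intro borel_measurable_continuous_onI continuous_intros matrix_vector_mult_linear_continuous_on)

text \<open>The denominator on the left is at least 1, the one on the right at most
  \<open>2 powr r\<close> because \<open>t + q\<close> is nonnegative; the numerators have the
  constant ratio \<open>exp (b * (q - p))\<close>. This bound carries integrability from one section
  of the joint density to another.\<close>

lemma gml_gen_shift_le:
  assumes "0 < a" "0 < b" "0 < r" "0 \<le> t" "0 \<le> q"
  shows "gml_gen a b r (t + p) \<le> 2 powr r * exp (b * (q - p)) * gml_gen a b r (t + q)"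
proof -
  have "exp (- a * (t + q)) \<le> 1"
    using assms by simp
  then have "(1 + exp (- a * (t + q))) powr r \<le> 2 powr r"
    using assms by (intro powr_mono2) (auto simp: add_nonneg_nonneg)
  then have 1: "1 \<le> 2 powr r / (1 + exp (- a * (t + q))) powr r"
    using one_plus_exp_pos[of "- a * (t + q)"] by (simp add: le_divide_eq_1_pos)
  have "1 powr r \<le> (1 + exp (- a * (t + p))) powr r"
    using assms by (intro powr_mono2) auto
  then have "gml_gen a b r (t + p) \<le> exp (- b * (t + p))"
    using one_plus_exp_pos[of "- a * (t + p)"] unfolding gml_gen_def
    by (simp add: divide_le_eq mult_le_cancel_left1)
  also have "\<dots> \<le> exp (- b * (t + p)) * (2 powr r / (1 + exp (- a * (t + q))) powr r)"
    using 1 by (simp only: mult_le_cancel_left1) simp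
  also have "exp (- b * (t + p)) = exp (b * (q - p)) * exp (- b * (t + q))"
    by (simp add: algebra_simps flip: exp_add)
  finally show ?thesis
    by (simp add: gml_gen_def mult_ac)
qed

section \<open>Integrals and null sets of Lebesgue measure\<close>

lemma integrable_lborel_translate:
  fixes g :: "'a::euclidean_space \<Rightarrow> real"
  shows "integrable lborel (\<lambda>x. g (x + c)) \<longleftrightarrow> integrable lborel g"
proof -
  have *: "integrable lborel (\<lambda>x. g (c + x))" if "integrable lborel g" for g :: "'a \<Rightarrow> real" and c
    using that borel_measurable_integrable[OF that]
    by (subst (asm) lborel_distr_plus[of c, symmetric], subst (asm) integrable_distr_eq) auto
  show ?thesis
    using *[of g c] *[of "\<lambda>x. g (x + c)" "- c"] by (auto simp: add.commute)
qed

text \<open>The whole space is not a null set, so a property that holds almost everywhere has a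
  witness.\<close>

lemma trivial_limit_lborel: "ae_filter (lborel :: 'a::euclidean_space measure) \<noteq> bot"
  by (simp add: trivial_limit_def AE_iff_measurable[OF _ refl])

text \<open>A nonnegative function with integral 0 vanishes almost everywhere, which a positive
  function on a non-null space cannot do.\<close>

lemma integral_lborel_pos:
  fixes f :: "'a::euclidean_space \<Rightarrow> real"
  assumes "integrable lborel f" "\<And>x. 0 < f x"
  shows "0 < (LINT x|lborel. f x)"
proof -
  have "\<not> (AE x in lborel. f x = 0)"
    using assms(2) by (simp add: less_imp_neq[symmetric] AE_iff_measurable[OF _ refl])
  moreover have "0 \<le> (LINT x|lborel. f x)"
    using assms(2) by (simp add: less_imp_le)
  ultimately show ?thesis
    using integral_nonneg_eq_0_iff_AE[OF assms(1)] assms(2) by (auto simp: less_imp_le order_less_le)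
qed

section \<open>Marginal and conditional laws\<close>

text \<open>Integrability of every section identifies the real integral in
  \<open>marginal_density1\<close> with the extended nonnegative integral of the general marginal
  law.\<close>

lemma distributed_marginal_density1:
  fixes X :: "'w \<Rightarrow> real ^ ('m::finite + 'k::finite)" and f :: "real ^ ('m + 'k) \<Rightarrow> real"
  assumes M: "prob_space M" and X: "distributed M lborel X (\<lambda>z. ennreal (f z))"
    and f: "\<And>z. 0 \<le> f z" "\<And>x. integrable lborel (\<lambda>y. f (join x y))"
  shows "distributed M lborel (\<lambda>\<omega>. part1 (X \<omega>)) (\<lambda>x. ennreal (marginal_density1 f x))"
  using prob_space.distr_marginal1[OF M _ _ distributed_parts[OF X]] f
  by (simp add: marginal_density1_def nn_integral_eq_integral lborel.sigma_finite_measure_axioms)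

text \<open>For fixed \<open>x\<close> the section and the elliptical kernel are proportional, so
  normalizing either gives the same density. The factor \<open>K\<close> and the determinant factor
  \<open>D\<close> both cancel.\<close>

lemma elliptical_cond_distr:
  fixes f :: "real ^ ('m::finite + 'k::finite) \<Rightarrow> real" and S :: "real ^ 'k ^ 'k"
  assumes S: "sym_pos_def S" and h: "\<And>u. 0 \<le> u \<Longrightarrow> 0 \<le> h u" and "0 < K"
    and f: "\<And>y. f (join x y) = K * h (quad S (y - m))"
    and int: "integrable lborel (\<lambda>y. f (join x y))" and pos: "0 < marginal_density1 f x"
  shows "elliptical (cond_distr f x) (\<lambda>y. y) m S h"
proof -
  define D where "D = det S powr (- 1 / 2)"
  \<comment> \<open>A nonzero determinant is enough here, since \<open>powr\<close> with nonzero
    base is an exponential.\<close>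
  have "0 < D"
    using sym_pos_def_invertible[OF S] by (simp add: D_def invertible_det_nz)
  have kernel: "ell_kernel m S h y = D / K * f (join x y)" for y
    using \<open>0 < K\<close> by (simp add: ell_kernel_def f D_def)
  have const: "ell_const m S h = K / D / marginal_density1 f x"
    unfolding ell_const_def kernel by (simp add: marginal_density1_def)
  have density: "ell_density m S h y = cond_density f x y" for y
    using \<open>0 < K\<close> \<open>0 < D\<close> by (simp add: ell_density_def kernel const cond_density_def)
  have [measurable]: "cond_density f x \<in> borel_measurable borel"
    using borel_measurable_integrable[OF int] by (simp add: cond_density_def[abs_def])
  have nonneg: "0 \<le> cond_density f x y" for y
    using pos \<open>0 < K\<close> h quad_nonneg[OF S] by (simp add: cond_density_def f)
  have "(\<integral>\<^sup>+y. ennreal (cond_density f x y) \<partial>lborel) = ennreal (LINT y|lborel. cond_density f x y)"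
    using nonneg int by (intro nn_integral_eq_integral) (auto simp: cond_density_def)
  also have "(LINT y|lborel. cond_density f x y) = 1"
    using pos by (simp add: cond_density_def marginal_density1_def)
  finally have "prob_space (cond_distr f x)"
    by (intro prob_spaceI) (simp add: cond_distr_def emeasure_density)
  moreover have "distributed (cond_distr f x) lborel (\<lambda>y. y) (\<lambda>y. ennreal (ell_density m S h y))"
    unfolding density distributed_def
    by (auto simp: cond_distr_def intro!: distr_id2)
  ultimately show ?thesis
    using S h pos \<open>0 < K\<close> \<open>0 < D\<close> by (simp add: elliptical_def const)
qed

theorem theorem4p2:
  fixes a b r :: real
    and M :: "'w measure"
    and X :: "'w \<Rightarrow> real ^ ('m::finite + 'k::finite)"
    and \<mu> :: "real ^ ('m + 'k)"
    and \<Sigma> :: "real ^ ('m + 'k) ^ ('m + 'k)"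
    and f :: "real ^ ('m + 'k) \<Rightarrow> real"
    and x1 :: "real ^ 'm"
  assumes "0 < a" and "0 < b" and "0 < r"
    and "GML M X \<mu> \<Sigma> a b r"
    and "f = ell_density \<mu> \<Sigma> (gml_gen a b r)"
  shows "distributed M lborel X (\<lambda>z. ennreal (f z)) \<and>
    distributed M lborel (\<lambda>\<omega>. part1 (X \<omega>)) (\<lambda>x. ennreal (marginal_density1 f x)) \<and>
    0 < marginal_density1 f x1 \<and>
    elliptical (cond_distr f x1) (\<lambda>x2. x2)
      (part2 \<mu> + (block21 \<Sigma> ** matrix_inv (block11 \<Sigma>)) *v (x1 - part1 \<mu>))
      (block22 \<Sigma> - block21 \<Sigma> ** matrix_inv (block11 \<Sigma>) ** block12 \<Sigma>)
      (\<lambda>t. exp (- b * (t + (x1 - part1 \<mu>) \<bullet> (matrix_inv (block11 \<Sigma>) *v (x1 - part1 \<mu>))))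
         / (1 + exp (- a * (t + (x1 - part1 \<mu>) \<bullet> (matrix_inv (block11 \<Sigma>) *v (x1 - part1 \<mu>)))))
           powr r)"
proof -
  let ?g = "gml_gen a b r"
  let ?S = "schur \<Sigma>"
  define q :: "real ^ 'm \<Rightarrow> real" where "q x = quad (block11 \<Sigma>) (x - part1 \<mu>)" for x
  define m :: "real ^ 'm \<Rightarrow> real ^ 'k" where
    "m x = part2 \<mu> + (block21 \<Sigma> ** matrix_inv (block11 \<Sigma>)) *v (x - part1 \<mu>)" for x
  \<comment> \<open>All factors of the joint density that depend on neither part of the vector;
    \<open>C\<close> becomes the \<open>K\<close> of \<open>elliptical_cond_distr\<close>.\<close>
  define C where "C = ell_const \<mu> \<Sigma> ?g * det \<Sigma> powr (- 1 / 2)"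
  have X: "distributed M lborel X (\<lambda>z. ennreal (f z))" and S: "sym_pos_def \<Sigma>"
    and M: "prob_space M" and c: "0 < ell_const \<mu> \<Sigma> ?g"
    using assms(4) by (auto simp: GML_def elliptical_def assms(5))
  have S': "sym_pos_def ?S"
    by (rule sym_pos_def_schur[OF S])
  have "0 < C"
    using c sym_pos_def_invertible[OF S] by (simp add: C_def invertible_det_nz)
  have q: "0 \<le> q x" for x
    by (simp add: q_def quad_nonneg sym_pos_def_block11 S)
  \<comment> \<open>For \<open>z = join x y - \<mu>\<close> the residual in
    \<open>quad_schur\<close> is exactly \<open>y - m x\<close>, and the first form is
    \<open>q x\<close>.\<close>
  have f_join: "f (join x y) = C * ?g (quad ?S (y - m x) + q x)" for x y
    by (simp add: assms(5) ell_density_def ell_kernel_def C_def q_def m_def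
        quad_schur[OF S, of "join x y - \<mu>"] part1_diff part2_diff matrix_vector_mul_assoc algebra_simps)
  have f_pos: "0 < f z" for z
    using \<open>0 < C\<close> gml_gen_pos f_join[of "part1 z" "part2 z"] by simp
  have [measurable]: "f \<in> borel_measurable borel"
    unfolding assms(5) ell_density_def ell_kernel_def by measurable
  \<comment> \<open>Tonelli: the iterated integral is the total mass 1, so the inner integral is
    finite for almost every \<open>x\<close>, hence for some \<open>x0\<close>.\<close>
  have "(\<integral>\<^sup>+x. \<integral>\<^sup>+y. ennreal (f (join x y)) \<partial>lborel \<partial>lborel) =
      (\<integral>\<^sup>+p. ennreal (f (join (fst p) (snd p))) \<partial>(lborel \<Otimes>\<^sub>M lborel))"
    by (subst lborel.nn_integral_fst[symmetric]) simp_all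
  also have "\<dots> = 1"
    using distributed_nn_integral[OF distributed_parts[OF X], of "\<lambda>_. 1"] M
    by (simp add: case_prod_beta' prob_space.emeasure_space_1)
  finally have "AE x in lborel. (\<integral>\<^sup>+y. ennreal (f (join x y)) \<partial>lborel) \<noteq> \<infinity>"
    by (intro nn_integral_PInf_AE) simp_all
  then obtain x0 where "(\<integral>\<^sup>+y. ennreal (f (join x0 y)) \<partial>lborel) \<noteq> \<infinity>"
    using eventually_happens' trivial_limit_lborel by blast
  then have "integrable lborel (\<lambda>y. f (join x0 y))"
    using f_pos by (intro integrableI_nonneg) (auto simp: less_imp_le less_top)
  then have "integrable lborel (\<lambda>y. ?g (quad ?S (y - m x0) + q x0))"
    using \<open>0 < C\<close> by (simp add: f_join)
  then have int0: "integrable lborel (\<lambda>v. ?g (quad ?S v + q x0))"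
    using integrable_lborel_translate[of "\<lambda>v. ?g (quad ?S v + q x0)" "- m x0"] by simp
  \<comment> \<open>Once centered at \<open>m x\<close>, the sections differ only in the shift
    \<open>q x\<close>, so the section at \<open>x0\<close> dominates each of them up to a constant.
    Thus integrability holds at every point, in particular at the given \<open>x1\<close>.\<close>
  have "integrable lborel (\<lambda>v. ?g (quad ?S v + q x))" for x
  proof (rule Bochner_Integration.integrable_bound)
    show "integrable lborel (\<lambda>v. 2 powr r * exp (b * (q x0 - q x)) * ?g (quad ?S v + q x0))"
      using int0 by simp
    show "AE v in lborel. norm (?g (quad ?S v + q x)) \<le>
        norm (2 powr r * exp (b * (q x0 - q x)) * ?g (quad ?S v + q x0))"
      using gml_gen_shift_le[OF assms(1-3) quad_nonneg[OF S'] q] gml_gen_pos[of a b r]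
      by (auto simp: abs_mult abs_of_pos)
  qed measurable
  then have int: "integrable lborel (\<lambda>y. f (join x y))" for x
    using integrable_lborel_translate[of "\<lambda>v. ?g (quad ?S v + q x)" "- m x"] by (simp add: f_join)
  have pos: "0 < marginal_density1 f x1"
    unfolding marginal_density1_def using int f_pos by (rule integral_lborel_pos)
  \<comment> \<open>The generator of the conditional law is \<open>?g\<close> shifted by the fixed
    amount \<open>q x1\<close>.\<close>
  have "elliptical (cond_distr f x1) (\<lambda>y. y) (m x1) ?S (\<lambda>t. ?g (t + q x1))"
    using S' gml_gen_pos \<open>0 < C\<close> f_join int pos
    by (rule elliptical_cond_distr[OF _ less_imp_le])
  then show ?thesis
    using X distributed_marginal_density1[OF M X less_imp_le[OF f_pos] int] pos
    by (simp add: m_def q_def quad_def schur_def gml_gen_def)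
qed

end
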